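(* Let $K$ be a field, and let $I\subset K[x_1,\ldots,x_n]$ be the polymatroidal ideal associated with a discrete polymatroid $\mathcal P$ on the ground set $[n]$ with complementary rank function $\tau$. Then \[ I=\bigcap_{F}\mathfrak p_F^{\,\tau(F)}, \] where the intersection is taken over all $F\subset[n]$ which are $\tau$-closed and $\tau$-inseparable.
   Context: For $\mathbf u=(u_1,\dots,u_n)\in\mathbb Z_{\ge0}^n$ write $|\mathbf u|=\sum_i u_i$ and $\mathbf x^{\mathbf u}=x_1^{u_1}\cdots x_n^{u_n}$, and for $F\subset[n]=\{1,\dots,n\}$ write $\mathbf u(F)=\sum_{i\in F}u_i$. A discrete polymatroid on the ground set $[n]$ is a nonempty finite set $\mathcal P\subset\mathbb Z_{\geq0}^n$ such that (1) if $\mathbf u\in\mathcal P$ and $\mathbf v\in\mathbb Z_{\ge 0}^n$ satisfies $\mathbf v\leq\mathbf u$ componentwise, then $\mathbf v\in\mathcal P$; (2) if $\mathbf u,\mathbf v\in\mathcal P$ with $|\mathbf u|<|\mathbf v|$, then there is $\mathbf w\in\mathcal P$ with $\mathbf u<\mathbf w\leq\mathbf u\vee\mathbf v$, where $\mathbf u\vee\mathbf v$ is the componentwise maximum. The set $B(\mathcal P)$ of bases consists of the $\mathbf u\in\mathcal P$ with $|\mathbf u|$ maximal; this maximal value $d$ is the rank of $\mathcal P$. The polymatroidal ideal associated with $\mathcal P$ is the monomial ideal generated by all $\mathbf x^{\mathbf u}$ with $\mathbf u\in B(\mathcal P)$. The rank function $\rho\colon2^{[n]}\to\mathbb Z_{\geq0}$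 is $\rho(F)=\max\{\mathbf u(F):\mathbf u\in B(\mathcal P)\}$ for $F\neq\emptyset$ and $\rho(\emptyset)=0$. The complementary rank function $\tau\colon2^{[n]}\to\mathbb Z_{\geq0}$ is $\tau(F)=d-\rho([n]\setminus F)$. A subset $F\subset[n]$ is $\tau$-closed if $\tau(G)<\tau(F)$ for every proper subset $G$ of $F$. It is $\tau$-separable if there exist non-empty subsets $G,H$ of $F$ with $G\cap H=\emptyset$, $G\cup H=F$ and $\tau(G)+\tau(H)=\tau(F)$; otherwise it is $\tau$-inseparable. $\mathfrak p_F$ denotes the monomial prime ideal generated by the $x_i$ with $i\in F$. The zeroth power of any ideal (including the zero ideal $\mathfrak p_\emptyset$) is the whole ring. *)

theory Defs
  imports "HOL-Library.Poly_Mapping" "HOL-Algebra.Ideal_Product"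
begin

text \<open>
  Vectors in \<open>\<int>\<^sub>\<ge>\<^sub>0\<^sup>n\<close>, and at the same time exponents of monomials in \<open>x_1, \<dots>, x_n\<close>, are finitely
  supported maps \<open>nat \<Rightarrow>\<^sub>0 nat\<close> with support in \<open>{1..n}\<close>. The type \<open>nat \<Rightarrow>\<^sub>0 nat\<close> carries a
  lexicographic order, which is not the one needed; all componentwise comparisons and
  maxima are therefore written on the underlying functions \<open>lookup u\<close>.
\<close>

type_synonym expvec = "nat \<Rightarrow>\<^sub>0 nat"

definition expvecs :: "nat \<Rightarrow> expvec set" where
  "expvecs n = {u. Poly_Mapping.keys u \<subseteq> {1..n}}"

definition vsum :: "expvec \<Rightarrow> nat set \<Rightarrow> nat" where
  "vsum u F = (\<Sum>i\<in>F. Poly_Mapping.lookup u i)"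

definition modulus :: "nat \<Rightarrow> expvec \<Rightarrow> nat" where
  "modulus n u = vsum u {1..n}"

definition discrete_polymatroid :: "nat \<Rightarrow> expvec set \<Rightarrow> bool" where
  "discrete_polymatroid n P \<longleftrightarrow>
     P \<noteq> {} \<and> finite P \<and> P \<subseteq> expvecs n \<and>
     (\<forall>u\<in>P. \<forall>v\<in>expvecs n. Poly_Mapping.lookup v \<le> Poly_Mapping.lookup u \<longrightarrow> v \<in> P) \<and>
     (\<forall>u\<in>P. \<forall>v\<in>P. modulus n u < modulus n v \<longrightarrow>
        (\<exists>w\<in>P. Poly_Mapping.lookup u < Poly_Mapping.lookup w \<and>
           Poly_Mapping.lookup w \<le> sup (Poly_Mapping.lookup u) (Poly_Mapping.lookup v)))"

definition bases :: "nat \<Rightarrow> expvec set \<Rightarrow> expvec set" where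
  "bases n P = {u \<in> P. \<forall>v\<in>P. modulus n v \<le> modulus n u}"

definition polymatroid_rank :: "nat \<Rightarrow> expvec set \<Rightarrow> nat" where
  "polymatroid_rank n P = Max (modulus n ` P)"

definition rank_fun :: "nat \<Rightarrow> expvec set \<Rightarrow> nat set \<Rightarrow> nat" where
  "rank_fun n P F = (if F = {} then 0 else Max ((\<lambda>u. vsum u F) ` bases n P))"

text \<open>
  The subtraction does not truncate: for \<open>A \<subseteq> {1..n}\<close> one has \<open>rank_fun n P A \<le> polymatroid_rank n P\<close>.
\<close>

definition compl_rank_fun :: "nat \<Rightarrow> expvec set \<Rightarrow> nat set \<Rightarrow> nat" where
  "compl_rank_fun n P F = polymatroid_rank n P - rank_fun n P ({1..n} - F)"

definition tau_closed :: "(nat set \<Rightarrow> nat) \<Rightarrow> nat set \<Rightarrow> bool" where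
  "tau_closed \<tau> F \<longleftrightarrow> (\<forall>G. G \<subset> F \<longrightarrow> \<tau> G < \<tau> F)"

definition tau_separable :: "(nat set \<Rightarrow> nat) \<Rightarrow> nat set \<Rightarrow> bool" where
  "tau_separable \<tau> F \<longleftrightarrow>
     (\<exists>G H. G \<noteq> {} \<and> H \<noteq> {} \<and> G \<inter> H = {} \<and> G \<union> H = F \<and> \<tau> G + \<tau> H = \<tau> F)"

abbreviation tau_inseparable :: "(nat set \<Rightarrow> nat) \<Rightarrow> nat set \<Rightarrow> bool" where
  "tau_inseparable \<tau> F \<equiv> \<not> tau_separable \<tau> F"

text \<open>
  The type \<open>expvec \<Rightarrow>\<^sub>0 'k\<close>, with the convolution product, is the polynomial ring over \<open>'k\<close> in
  countably many variables; \<open>K[x_1, \<dots>, x_n]\<close> is its subring of polynomials all of whose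
  monomials only involve \<open>x_1, \<dots>, x_n\<close>.
\<close>

definition poly_ring :: "nat \<Rightarrow> (expvec \<Rightarrow>\<^sub>0 'k::field) ring" where
  "poly_ring n = \<lparr>carrier = {p. Poly_Mapping.keys p \<subseteq> expvecs n}, mult = (*), one = 1, zero = 0, add = (+)\<rparr>"

definition xmonom :: "expvec \<Rightarrow> (expvec \<Rightarrow>\<^sub>0 'k::field)" where
  "xmonom u = Poly_Mapping.single u 1"

definition xvar :: "nat \<Rightarrow> (expvec \<Rightarrow>\<^sub>0 'k::field)" where
  "xvar i = xmonom (Poly_Mapping.single i 1)"

definition polymatroidal_ideal :: "nat \<Rightarrow> expvec set \<Rightarrow> (expvec \<Rightarrow>\<^sub>0 'k::field) set" where
  "polymatroidal_ideal n P = Idl\<^bsub>poly_ring n\<^esub> (xmonom ` bases n P)"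

definition monomial_prime :: "nat \<Rightarrow> nat set \<Rightarrow> (expvec \<Rightarrow>\<^sub>0 'k::field) set" where
  "monomial_prime n F = Idl\<^bsub>poly_ring n\<^esub> (xvar ` F)"

text \<open>
  Powers of ideals are powers in the multiplicative monoid of ideals; its unit is the whole
  ring, so the zeroth power of every ideal is the whole ring.
\<close>

definition ideal_power :: "nat \<Rightarrow> (expvec \<Rightarrow>\<^sub>0 'k::field) set \<Rightarrow> nat \<Rightarrow> (expvec \<Rightarrow>\<^sub>0 'k) set" where
  "ideal_power n J k = J [^]\<^bsub>ideals_set (poly_ring n)\<^esub> k"

lemma poly_ring_cring: "cring (poly_ring n :: (expvec \<Rightarrow>\<^sub>0 'k::field) ring)"
proof (rule cringI)
  let ?R = "poly_ring n :: (expvec \<Rightarrow>\<^sub>0 'k) ring"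
  have add: "Poly_Mapping.keys (p + q) \<subseteq> expvecs n" if "Poly_Mapping.keys p \<subseteq> expvecs n" "Poly_Mapping.keys q \<subseteq> expvecs n"
    for p q :: "expvec \<Rightarrow>\<^sub>0 'k"
    using that Poly_Mapping.keys_add[of p q] by blast
  have mult: "Poly_Mapping.keys (p * q) \<subseteq> expvecs n" if "Poly_Mapping.keys p \<subseteq> expvecs n" "Poly_Mapping.keys q \<subseteq> expvecs n"
    for p q :: "expvec \<Rightarrow>\<^sub>0 'k"
  proof
    fix u assume "u \<in> Poly_Mapping.keys (p * q)"
    then obtain a b where "u = a + b" "a \<in> Poly_Mapping.keys p" "b \<in> Poly_Mapping.keys q"
      using Poly_Mapping.keys_mult[of p q] by blast
    then show "u \<in> expvecs n"
      using that Poly_Mapping.keys_add[of a b] unfolding expvecs_def by blast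
  qed
  have one: "0 \<in> expvecs n"
    by (simp add: expvecs_def)
  show "abelian_group ?R"
  proof (rule abelian_groupI)
    fix x assume "x \<in> carrier ?R"
    then show "\<exists>y\<in>carrier ?R. y \<oplus>\<^bsub>?R\<^esub> x = \<zero>\<^bsub>?R\<^esub>"
      by (intro bexI[of _ "- x"]) (auto simp: poly_ring_def)
  qed (auto simp: poly_ring_def add_ac dest: add)
  show "Group.comm_monoid ?R"
    by (rule comm_monoidI) (auto simp: poly_ring_def mult_ac one dest: mult[THEN subsetD])
  show "(x \<oplus>\<^bsub>?R\<^esub> y) \<otimes>\<^bsub>?R\<^esub> z = x \<otimes>\<^bsub>?R\<^esub> z \<oplus>\<^bsub>?R\<^esub> y \<otimes>\<^bsub>?R\<^esub> z" for x y z
    by (simp add: poly_ring_def distrib_right)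
qed

end

theory Submission
  imports Defs
begin

text \<open>
  Both sides of the identity are monomial ideals, so it suffices to compare the monomials they
  contain. A monomial \<open>x\<^sup>u\<close> lies in \<open>I\<close> iff \<open>u\<close> dominates a basis componentwise, and it lies in
  \<open>\<pp>\<^sub>F\<^sup>k\<close> iff \<open>u(F) \<ge> k\<close>. What remains is combinatorial: \<open>u\<close> dominates a basis iff
  \<open>u(F) \<ge> \<tau>(F)\<close> for all closed and inseparable \<open>F\<close>.

  If \<open>u \<ge> b\<close> for a basis \<open>b\<close>, then \<open>u(F) \<ge> b(F) = d - b([n] - F) \<ge> d - \<rho>([n] - F) = \<tau>(F)\<close> for
  every \<open>F\<close>. Conversely, the inequalities for closed inseparable sets imply those for all sets, by
  induction on \<open>|F|\<close>: if \<open>F\<close> is not closed, a proper subset has at least the same \<open>\<tau>\<close>; if \<open>F\<close> is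
  separable, the inequalities of its two parts add up
  (lemma \<open>closed_inseparable_inequalities_suffice\<close>). Now choose \<open>v \<in> P\<close> below \<open>u\<close> with \<open>|v|\<close>
  maximal, and let \<open>T\<close> be the set of directions \<open>i\<close> with \<open>v + e\<^sub>i \<notin> P\<close>. The key fact is that \<open>v\<close>
  already attains the rank of \<open>T\<close>, that is, \<open>\<rho>(T) \<le> v(T)\<close> (lemma \<open>blocked_directions_tight\<close>).
  Outside \<open>T\<close>, maximality of \<open>v\<close> forces \<open>v\<^sub>i = u\<^sub>i\<close>. With \<open>F = [n] - T\<close> this gives
  \<open>|v| = v(T) + u(F) \<ge> \<rho>(T) + \<tau>(F) = d\<close>, so \<open>v\<close> is a basis below \<open>u\<close>.
\<close>

section \<open>Monomial ideals and their products\<close>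

text \<open>
  This is the \<open>K\<close>-span of the monomials with exponent in \<open>U\<close>. Every ideal in the theorem has this
  form, so that equations between ideals become equations between sets of exponents.
\<close>

definition supported_on :: "expvec set \<Rightarrow> (expvec \<Rightarrow>\<^sub>0 'k::field) set" where
  "supported_on U = {p. Poly_Mapping.keys p \<subseteq> U}"

lemma add_in_expvecs: "u \<in> expvecs n \<Longrightarrow> v \<in> expvecs n \<Longrightarrow> u + v \<in> expvecs n"
  using Poly_Mapping.keys_add[of u v] unfolding expvecs_def by blast

lemma diff_in_expvecs: "u \<in> expvecs n \<Longrightarrow> u - v \<in> expvecs n"
  unfolding expvecs_def by (auto simp: in_keys_iff lookup_minus)

lemma single_in_expvecs: "i \<in> {1..n} \<Longrightarrow> Poly_Mapping.single i c \<in> expvecs n"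
  by (auto simp: expvecs_def)

lemma carrier_poly_ring: "carrier (poly_ring n) = supported_on (expvecs n)"
  by (simp add: poly_ring_def supported_on_def)

lemma supported_on_subset_additive:
  fixes J :: "(expvec \<Rightarrow>\<^sub>0 'k::field) set"
  assumes zero: "0 \<in> J" and add: "\<And>p q. p \<in> J \<Longrightarrow> q \<in> J \<Longrightarrow> p + q \<in> J"
    and single: "\<And>u c. u \<in> U \<Longrightarrow> Poly_Mapping.single u c \<in> J"
  shows "supported_on U \<subseteq> J"
proof
  fix p :: "expvec \<Rightarrow>\<^sub>0 'k" assume p: "p \<in> supported_on U"
  have "p = (\<Sum>u\<in>Poly_Mapping.keys p. Poly_Mapping.single u (Poly_Mapping.lookup p u))"
    by (rule poly_mapping_eqI)
       (auto simp: lookup_sum lookup_single when_def in_keys_iff sum.delta)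
  moreover have "(\<Sum>u\<in>A. Poly_Mapping.single u (Poly_Mapping.lookup p u)) \<in> J"
    if "finite A" "A \<subseteq> U" for A
    using that by (induction A rule: finite_induct) (auto intro: zero add single)
  ultimately show "p \<in> J"
    using p by (metis finite_keys mem_Collect_eq supported_on_def)
qed

lemma times_in_supported_on:
  assumes "p \<in> supported_on U" "q \<in> supported_on V" "\<And>u v. u \<in> U \<Longrightarrow> v \<in> V \<Longrightarrow> u + v \<in> W"
  shows "p * q \<in> supported_on W"
  using assms Poly_Mapping.keys_mult[of p q] unfolding supported_on_def by blast

lemma plus_in_supported_on:
  "p \<in> supported_on U \<Longrightarrow> q \<in> supported_on U \<Longrightarrow> p + q \<in> supported_on U"
  using Poly_Mapping.keys_add[of p q] unfolding supported_on_def by blast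

lemma supported_on_ideal:
  assumes sub: "U \<subseteq> expvecs n" and up: "\<And>u w. u \<in> U \<Longrightarrow> w \<in> expvecs n \<Longrightarrow> u + w \<in> U"
  shows "ideal (supported_on U :: (expvec \<Rightarrow>\<^sub>0 'k::field) set) (poly_ring n)"
proof -
  let ?R = "poly_ring n :: (expvec \<Rightarrow>\<^sub>0 'k) ring" and ?S = "supported_on U :: (expvec \<Rightarrow>\<^sub>0 'k) set"
  interpret cring ?R by (rule poly_ring_cring)
  have carrier: "?S \<subseteq> carrier ?R"
    using sub by (auto simp: carrier_poly_ring supported_on_def)
  have mult: "x \<otimes>\<^bsub>?R\<^esub> a \<in> ?S" if "a \<in> ?S" "x \<in> carrier ?R" for a x
    using times_in_supported_on[OF that(1) that(2)[unfolded carrier_poly_ring], of U] up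
    by (simp add: poly_ring_def mult.commute)
  have "subgroup ?S (add_monoid ?R)"
  proof (rule add.subgroupI)
    show "?S \<subseteq> carrier ?R" by (rule carrier)
    show "?S \<noteq> {}" by (auto simp: supported_on_def intro: exI[of _ 0])
    show "\<ominus>\<^bsub>?R\<^esub> a \<in> ?S" if a: "a \<in> ?S" for a
    proof -
      have "a \<in> carrier ?R" using a carrier by auto
      then have "\<ominus>\<^bsub>?R\<^esub> a = (\<ominus>\<^bsub>?R\<^esub> \<one>\<^bsub>?R\<^esub>) \<otimes>\<^bsub>?R\<^esub> a"
        by (simp add: l_minus)
      then show ?thesis using mult[OF a] by simp
    qed
    show "a \<oplus>\<^bsub>?R\<^esub> b \<in> ?S" if "a \<in> ?S" "b \<in> ?S" for a b
      using plus_in_supported_on[OF that] by (simp add: poly_ring_def)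
  qed
  then show ?thesis
  proof (rule idealI[OF ring_axioms])
    show "x \<otimes>\<^bsub>?R\<^esub> a \<in> ?S" if "a \<in> ?S" "x \<in> carrier ?R" for a x
      using mult that .
    show "a \<otimes>\<^bsub>?R\<^esub> x \<in> ?S" if "a \<in> ?S" "x \<in> carrier ?R" for a x
      using mult[OF that] that carrier m_comm by auto
  qed
qed

text \<open>
  The monomials divisible by a generator span an ideal, and each of them is a multiple of a
  generator; hence this span is the generated ideal.
\<close>

lemma genideal_monomials:
  assumes sub: "B \<subseteq> expvecs n"
  shows "(Idl\<^bsub>poly_ring n\<^esub> (xmonom ` B) :: (expvec \<Rightarrow>\<^sub>0 'k::field) set)
    = supported_on {b + w | b w. b \<in> B \<and> w \<in> expvecs n}"
    (is "?I = supported_on ?U")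
proof
  let ?R = "poly_ring n :: (expvec \<Rightarrow>\<^sub>0 'k) ring"
  interpret cring ?R by (rule poly_ring_cring)
  have zero: "0 \<in> expvecs n" by (simp add: expvecs_def)
  have gens: "xmonom ` B \<subseteq> carrier ?R"
    using sub by (auto simp: poly_ring_def xmonom_def)
  interpret I: ideal ?I ?R by (rule genideal_ideal[OF gens])
  have "?U \<subseteq> expvecs n" using sub by (auto intro: add_in_expvecs)
  moreover have "u + w \<in> ?U" if "u \<in> ?U" "w \<in> expvecs n" for u w
    using that add_in_expvecs by (fastforce simp: add.assoc)
  ultimately have "ideal (supported_on ?U :: (expvec \<Rightarrow>\<^sub>0 'k) set) ?R"
    by (rule supported_on_ideal)
  moreover have "xmonom b \<in> supported_on ?U" if "b \<in> B" for b
    using that zero by (force simp: xmonom_def supported_on_def)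
  ultimately show "?I \<subseteq> supported_on ?U"
    by (intro genideal_minimal) auto
  show "supported_on ?U \<subseteq> ?I"
  proof (rule supported_on_subset_additive)
    show "0 \<in> ?I" using I.zero_closed by (simp add: poly_ring_def)
    show "p + q \<in> ?I" if "p \<in> ?I" "q \<in> ?I" for p q
      using I.a_closed[OF that] by (simp add: poly_ring_def)
    show "Poly_Mapping.single u c \<in> ?I" if u: "u \<in> ?U" for u and c :: 'k
    proof -
      obtain b w where bw: "u = b + w" "b \<in> B" "w \<in> expvecs n" using u by blast
      have "xmonom b \<in> ?I" using genideal_self[OF gens] bw(2) by blast
      moreover have "Poly_Mapping.single w c \<in> carrier ?R"
        using bw(3) by (auto simp: poly_ring_def)
      ultimately have "xmonom b \<otimes>\<^bsub>?R\<^esub> Poly_Mapping.single w c \<in> ?I"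
        by (rule I.I_r_closed)
      then show ?thesis by (simp add: poly_ring_def xmonom_def mult_single bw(1))
    qed
  qed
qed

text \<open>
  Since \<open>c x\<^sup>u\<^sup>+\<^sup>v = (c x\<^sup>u) x\<^sup>v\<close>, products of ideals spanned by monomials correspond to
  sumsets of exponents.
\<close>

lemma ideal_prod_supported_on:
  "ideal_prod (poly_ring n) (supported_on U) (supported_on V)
    = (supported_on {u + v | u v. u \<in> U \<and> v \<in> V} :: (expvec \<Rightarrow>\<^sub>0 'k::field) set)"
    (is "?J = supported_on ?W")
proof
  let ?R = "poly_ring n :: (expvec \<Rightarrow>\<^sub>0 'k) ring"
  have prodI: "p * q \<in> ?J" if "p \<in> supported_on U" "q \<in> supported_on V" for p q :: "expvec \<Rightarrow>\<^sub>0 'k"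
    using ideal_prod.prod[OF that, of ?R] by (simp add: poly_ring_def)
  show "?J \<subseteq> supported_on ?W"
  proof
    fix p assume "p \<in> ?J"
    then show "p \<in> supported_on ?W"
    proof induction
      case (prod p q)
      then have "p * q \<in> supported_on ?W"
        by (rule times_in_supported_on) auto
      then show ?case by (simp add: poly_ring_def)
    next
      case (sum p q)
      then have "p + q \<in> supported_on ?W" by (intro plus_in_supported_on)
      then show ?case by (simp add: poly_ring_def)
    qed
  qed
  show "supported_on ?W \<subseteq> ?J"
  proof (rule supported_on_subset_additive)
    show "0 \<in> ?J" using prodI[of 0 0] by (simp add: supported_on_def)
    show "p + q \<in> ?J" if "p \<in> ?J" "q \<in> ?J" for p q
      using ideal_prod.sum[OF that] by (simp add: poly_ring_def)
    show "Poly_Mapping.single w c \<in> ?J" if "w \<in> ?W" for w and c :: 'k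
    proof -
      obtain u v where "w = u + v" "u \<in> U" "v \<in> V" using \<open>w \<in> ?W\<close> by blast
      then show ?thesis
        using prodI[of "Poly_Mapping.single u c" "Poly_Mapping.single v 1"]
        by (simp add: supported_on_def mult_single)
    qed
  qed
qed

lemma vsum_add: "vsum (u + v) F = vsum u F + vsum v F"
  by (simp add: vsum_def lookup_add sum.distrib)

text \<open>
  An exponent with \<open>u(F) > 0\<close> contains some \<open>e\<^sub>i\<close> with \<open>i \<in> F\<close>; splitting it off lowers \<open>u(F)\<close> by
  exactly one. This is what makes powers of a monomial prime computable one factor at a time.
\<close>

lemma split_off_unit_vector:
  assumes "u \<in> expvecs n" "F \<subseteq> {1..n}" "0 < vsum u F"
  obtains i w where "i \<in> F" "w \<in> expvecs n" "u = w + Poly_Mapping.single i 1"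
    "vsum u F = Suc (vsum w F)"
proof -
  have fin: "finite F" using assms(2) finite_subset by blast
  obtain i where i: "i \<in> F" "0 < Poly_Mapping.lookup u i"
    using assms(3) by (metis sum.neutral gr0I less_numeral_extra(3) vsum_def)
  let ?w = "u - Poly_Mapping.single i 1"
  have u: "u = ?w + Poly_Mapping.single i 1"
    using i(2) by (intro poly_mapping_eqI) (auto simp: lookup_add lookup_minus lookup_single when_def)
  have "vsum (Poly_Mapping.single i 1) F = 1"
    using fin i(1) by (simp add: vsum_def lookup_single when_def)
  then have "vsum u F = Suc (vsum ?w F)"
    using vsum_add[of ?w "Poly_Mapping.single i 1" F] u by simp
  then show ?thesis using that[OF i(1) diff_in_expvecs[OF assms(1)] u] by blast
qed

lemma monomial_prime_supported_on:
  assumes F: "F \<subseteq> {1..n}"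
  shows "(monomial_prime n F :: (expvec \<Rightarrow>\<^sub>0 'k::field) set)
    = supported_on {u \<in> expvecs n. 1 \<le> vsum u F}"
proof -
  let ?E = "(\<lambda>i. Poly_Mapping.single i (1::nat)) ` F"
  have fin: "finite F" using F finite_subset by blast
  have "?E \<subseteq> expvecs n" using F by (blast intro: single_in_expvecs)
  moreover have "(xvar ` F :: (expvec \<Rightarrow>\<^sub>0 'k) set) = xmonom ` ?E" by (auto simp: xvar_def)
  moreover have "{e + w | e w. e \<in> ?E \<and> w \<in> expvecs n} = {u \<in> expvecs n. 1 \<le> vsum u F}"
  proof (intro equalityI subsetI)
    fix u assume "u \<in> {e + w | e w. e \<in> ?E \<and> w \<in> expvecs n}"
    then obtain i w where iw: "i \<in> F" "w \<in> expvecs n" "u = Poly_Mapping.single i 1 + w" by auto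
    have "vsum (Poly_Mapping.single i 1) F = 1"
      using fin iw(1) by (simp add: vsum_def lookup_single when_def)
    moreover have "u \<in> expvecs n"
      using iw F by (auto intro!: add_in_expvecs single_in_expvecs)
    ultimately show "u \<in> {u \<in> expvecs n. 1 \<le> vsum u F}"
      using iw(3) by (simp add: vsum_add)
  next
    fix u assume "u \<in> {u \<in> expvecs n. 1 \<le> vsum u F}"
    then have "u \<in> expvecs n" "0 < vsum u F" by auto
    from split_off_unit_vector[OF this(1) F this(2)] obtain i w
      where "i \<in> F" "w \<in> expvecs n" "u = w + Poly_Mapping.single i 1" .
    then show "u \<in> {e + w | e w. e \<in> ?E \<and> w \<in> expvecs n}"
      using add.commute[of w] by blast
  qed
  ultimately show ?thesis
    unfolding monomial_prime_def using genideal_monomials[of ?E n, where 'k = 'k] by simp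
qed

lemma monomial_prime_power_supported_on:
  assumes F: "F \<subseteq> {1..n}"
  shows "ideal_power n (monomial_prime n F) k
    = (supported_on {u \<in> expvecs n. k \<le> vsum u F} :: (expvec \<Rightarrow>\<^sub>0 'k::field) set)"
proof (induction k)
  case 0
  then show ?case
    by (simp add: ideal_power_def ideals_set_def carrier_poly_ring)
next
  case (Suc k)
  let ?U = "\<lambda>k. {u \<in> expvecs n. k \<le> vsum u F}"
  have "{u + v | u v. u \<in> ?U k \<and> v \<in> ?U 1} = ?U (Suc k)"
  proof (intro equalityI subsetI)
    fix u assume "u \<in> {u + v | u v. u \<in> ?U k \<and> v \<in> ?U 1}"
    then show "u \<in> ?U (Suc k)" by (auto simp: vsum_add intro: add_in_expvecs)
  next
    fix u assume "u \<in> ?U (Suc k)"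
    then have u: "u \<in> expvecs n" "0 < vsum u F" "Suc k \<le> vsum u F" by auto
    obtain i w where iw: "i \<in> F" "w \<in> expvecs n" "u = w + Poly_Mapping.single i 1"
      "vsum u F = Suc (vsum w F)"
      using split_off_unit_vector[OF u(1) F u(2)] .
    have "w \<in> ?U k" using iw u(3) by simp
    moreover have "Poly_Mapping.single i 1 \<in> ?U 1"
      using iw F vsum_add[of w "Poly_Mapping.single i 1" F]
      by (auto intro!: single_in_expvecs)
    ultimately show "u \<in> {u + v | u v. u \<in> ?U k \<and> v \<in> ?U 1}" using iw(3) by blast
  qed
  moreover have "ideal_power n (monomial_prime n F) (Suc k)
      = ideal_prod (poly_ring n) (ideal_power n (monomial_prime n F) k)
          (monomial_prime n F :: (expvec \<Rightarrow>\<^sub>0 'k) set)"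
    by (simp add: ideal_power_def ideals_set_def)
  ultimately show ?case
    using Suc ideal_prod_supported_on[of n "?U k" "?U 1", where 'k = 'k]
    by (simp add: monomial_prime_supported_on[OF F])
qed

section \<open>Discrete polymatroids\<close>

text \<open>
  Members of \<open>P\<close> are produced below from explicit functions; this is the downward closure
  of \<open>P\<close> in that form.
\<close>

lemma polymatroid_down:
  assumes P: "discrete_polymatroid n P" and u: "u \<in> P" and f: "\<And>i. f i \<le> Poly_Mapping.lookup u i"
  obtains v where "v \<in> P" "\<And>i. Poly_Mapping.lookup v i = f i"
proof -
  have "{i. f i \<noteq> 0} \<subseteq> Poly_Mapping.keys u"
    using f by (metis (mono_tags, lifting) in_keys_iff le_zero_eq mem_Collect_eq subsetI)
  then have "finite {i. f i \<noteq> 0}" using finite_subset finite_keys by blast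
  then have look: "Poly_Mapping.lookup (Poly_Mapping.Abs_poly_mapping f) = f" by simp
  have "u \<in> expvecs n" using P u unfolding discrete_polymatroid_def by blast
  then have "Poly_Mapping.Abs_poly_mapping f \<in> expvecs n"
    using f look \<open>{i. f i \<noteq> 0} \<subseteq> Poly_Mapping.keys u\<close> unfolding expvecs_def
    by (metis (no_types, lifting) Collect_mono_iff dual_order.trans keys.rep_eq mem_Collect_eq)
  then have "Poly_Mapping.Abs_poly_mapping f \<in> P"
    using P u f look unfolding discrete_polymatroid_def by (metis le_funI)
  then show ?thesis using that look by metis
qed

lemma polymatroid_exchange:
  assumes P: "discrete_polymatroid n P" and "u \<in> P" "v \<in> P" "modulus n u < modulus n v"
  obtains w where "w \<in> P" "\<And>i. Poly_Mapping.lookup u i \<le> Poly_Mapping.lookup w i"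
    "\<And>i. Poly_Mapping.lookup w i \<le> max (Poly_Mapping.lookup u i) (Poly_Mapping.lookup v i)"
    "\<exists>i. Poly_Mapping.lookup u i < Poly_Mapping.lookup w i"
proof -
  obtain w where "w \<in> P" and w: "Poly_Mapping.lookup u < Poly_Mapping.lookup w"
    "Poly_Mapping.lookup w \<le> sup (Poly_Mapping.lookup u) (Poly_Mapping.lookup v)"
    using assms unfolding discrete_polymatroid_def by blast
  show ?thesis
  proof (rule that[OF \<open>w \<in> P\<close>])
    show "Poly_Mapping.lookup u i \<le> Poly_Mapping.lookup w i" for i
      by (rule le_funD[OF less_imp_le[OF w(1)]])
    show "Poly_Mapping.lookup w i \<le> max (Poly_Mapping.lookup u i) (Poly_Mapping.lookup v i)" for i
      using w(2) by (simp add: le_fun_def sup_max)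
    show "\<exists>i. Poly_Mapping.lookup u i < Poly_Mapping.lookup w i"
      using w(1) by (metis le_funI less_le_not_le not_le)
  qed
qed

lemma polymatroid_lookup_outside:
  assumes "discrete_polymatroid n P" "u \<in> P" "i \<notin> {1..n}"
  shows "Poly_Mapping.lookup u i = 0"
proof -
  have "u \<in> expvecs n" using assms(1,2) unfolding discrete_polymatroid_def by blast
  then show ?thesis using assms(3) unfolding expvecs_def by (meson in_keys_iff mem_Collect_eq subsetD)
qed

lemma ex_max_if_finite:
  fixes f :: "'a \<Rightarrow> nat"
  assumes "finite Z" "z0 \<in> Z"
  shows "\<exists>z\<in>Z. \<forall>x\<in>Z. f x \<le> f z"
proof -
  have "Max (f ` Z) \<in> f ` Z" using assms by (intro Max_in) auto
  then obtain z where "z \<in> Z" "f z = Max (f ` Z)" by auto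
  then show ?thesis using assms(1) by (metis Max_ge finite_imageI imageI)
qed

lemma modulus_split:
  assumes "F \<subseteq> {1..n}" shows "modulus n u = vsum u F + vsum u ({1..n} - F)"
  using sum.subset_diff[OF assms, of "Poly_Mapping.lookup u"]
  by (simp add: modulus_def vsum_def add.commute)

lemma vsum_mono:
  "(\<And>i. i \<in> F \<Longrightarrow> Poly_Mapping.lookup u i \<le> Poly_Mapping.lookup v i) \<Longrightarrow> vsum u F \<le> vsum v F"
  by (simp add: vsum_def sum_mono)

lemma modulus_less:
  assumes "\<And>i. Poly_Mapping.lookup u i \<le> Poly_Mapping.lookup v i"
    and "i \<in> {1..n}" "Poly_Mapping.lookup u i < Poly_Mapping.lookup v i"
  shows "modulus n u < modulus n v"
  unfolding modulus_def vsum_def using assms by (intro sum_strict_mono_ex1) auto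

lemma modulus_add_unit:
  assumes "i \<in> {1..n}" shows "modulus n (v + Poly_Mapping.single i 1) = Suc (modulus n v)"
  using assms by (simp add: modulus_def vsum_add) (simp add: vsum_def lookup_single when_def)

text \<open>
  Suppose \<open>w(T) > v(T)\<close>. Exchange between the restrictions of \<open>v\<close> and \<open>w\<close> to \<open>T\<close> yields a member
  of \<open>P\<close> above \<open>v|\<^sub>T + e\<^sub>i\<close> for some \<open>i \<in> T\<close>. Let \<open>z\<close> be a member of largest modulus between
  \<open>v|\<^sub>T + e\<^sub>i\<close> and \<open>v + e\<^sub>i\<close>. As \<open>v + e\<^sub>i \<notin> P\<close>, some coordinate \<open>j\<close> has \<open>z\<^sub>j < v\<^sub>j\<close>, and \<open>j\<close> lies
  outside \<open>T\<close>, so \<open>v + e\<^sub>j \<in> P\<close> and \<open>|z| < |v + e\<^sub>i| = |v + e\<^sub>j|\<close>. Exchanging \<open>z\<close> with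
  \<open>v + e\<^sub>j\<close> gives \<open>x > z\<close> in \<open>P\<close> with \<open>x \<le> v + e\<^sub>i + e\<^sub>j\<close>. Capping \<open>x\<close> at \<open>v + e\<^sub>i\<close> must
  give back \<open>z\<close>, by the maximality of \<open>z\<close>, so \<open>x\<close> exceeds \<open>z\<close> only where it exceeds \<open>v + e\<^sub>i\<close>.
  That can only be at \<open>j\<close>, with \<open>z\<^sub>j = v\<^sub>j\<close>, a contradiction.
\<close>

lemma blocked_directions_tight:
  assumes P: "discrete_polymatroid n P" and v: "v \<in> P" and w: "w \<in> P"
  defines "T \<equiv> {i \<in> {1..n}. v + Poly_Mapping.single i 1 \<notin> P}"
  shows "vsum w T \<le> vsum v T"
proof (rule ccontr)
  let ?l = Poly_Mapping.lookup
  have T: "T \<subseteq> {1..n}" by (auto simp: T_def)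
  assume "\<not> vsum w T \<le> vsum v T"
  obtain vT where vT: "vT \<in> P" "\<And>i. ?l vT i = (if i \<in> T then ?l v i else 0)"
    by (rule polymatroid_down[OF P v, of "\<lambda>i. if i \<in> T then ?l v i else 0"]) auto
  obtain wT where wT: "wT \<in> P" "\<And>i. ?l wT i = (if i \<in> T then ?l w i else 0)"
    by (rule polymatroid_down[OF P w, of "\<lambda>i. if i \<in> T then ?l w i else 0"]) auto
  have "modulus n vT = vsum v T" "modulus n wT = vsum w T"
    by (simp_all add: modulus_split[OF T] vsum_def vT wT)
  then have "modulus n vT < modulus n wT" using \<open>\<not> vsum w T \<le> vsum v T\<close> by simp
  then obtain y where y: "y \<in> P" "\<And>i. ?l vT i \<le> ?l y i"
    "\<And>i. ?l y i \<le> max (?l vT i) (?l wT i)" "\<exists>i. ?l vT i < ?l y i"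
    using polymatroid_exchange[OF P vT(1) wT(1)] by blast
  then obtain i where i: "?l vT i < ?l y i" by blast
  have "i \<in> T" using i y(3)[of i] by (auto simp: vT wT split: if_splits)
  let ?vi = "v + Poly_Mapping.single i 1"
  have look: "?l (v + Poly_Mapping.single j 1) k = ?l v k + (if k = j then 1 else 0)" for j k
    by (simp add: lookup_add lookup_single when_def)
  obtain z0 where z0: "z0 \<in> P" "\<And>k. ?l z0 k = ?l vT k + (if k = i then 1 else 0)"
  proof (rule polymatroid_down[OF P y(1)])
    show "?l vT k + (if k = i then 1 else 0) \<le> ?l y k" for k
      using i y(2)[of k] by auto
  qed blast
  define Z where "Z = {z \<in> P. \<forall>k. ?l z0 k \<le> ?l z k \<and> ?l z k \<le> ?l ?vi k}"
  have "z0 \<in> Z" using z0 unfolding Z_def look by (auto simp: vT)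
  moreover have "finite Z" using P by (simp add: Z_def discrete_polymatroid_def)
  ultimately obtain z where z: "z \<in> Z" "\<And>x. x \<in> Z \<Longrightarrow> modulus n x \<le> modulus n z"
    using ex_max_if_finite[of Z _ "modulus n"] by blast
  have zP: "z \<in> P" and z_ge: "\<And>k. ?l z0 k \<le> ?l z k" and z_le: "\<And>k. ?l z k \<le> ?l ?vi k"
    using z(1) by (auto simp: Z_def)
  have "?vi \<notin> P" using \<open>i \<in> T\<close> by (simp add: T_def)
  then have "z \<noteq> ?vi" using zP by blast
  then obtain j where j: "?l z j \<noteq> ?l ?vi j" by (metis poly_mapping_eqI)
  have "j \<notin> T" "?l z j < ?l v j"
    using j z_le[of j] z_ge[of j] \<open>i \<in> T\<close> unfolding look z0 vT by (auto split: if_splits)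
  have "j \<in> {1..n}"
    using polymatroid_lookup_outside[OF P v, of j] \<open>?l z j < ?l v j\<close> by linarith
  then have vj: "v + Poly_Mapping.single j 1 \<in> P" using \<open>j \<notin> T\<close> by (simp add: T_def)
  have "modulus n z < modulus n ?vi"
    using modulus_less[OF z_le \<open>j \<in> {1..n}\<close>] j z_le[of j] by simp
  also have "\<dots> = modulus n (v + Poly_Mapping.single j 1)"
    using T \<open>i \<in> T\<close> \<open>j \<in> {1..n}\<close> by (metis modulus_add_unit subsetD)
  finally obtain x where x: "x \<in> P" "\<And>k. ?l z k \<le> ?l x k"
    "\<And>k. ?l x k \<le> max (?l z k) (?l (v + Poly_Mapping.single j 1) k)" "\<exists>k. ?l z k < ?l x k"
    using polymatroid_exchange[OF P zP vj] by blast
  obtain x' where x': "x' \<in> P" "\<And>k. ?l x' k = min (?l x k) (?l ?vi k)"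
    by (rule polymatroid_down[OF P x(1), of "\<lambda>k. min (?l x k) (?l ?vi k)"]) auto
  have z_x': "?l z k \<le> ?l x' k" for k using x(2) z_le by (simp add: x')
  have "?l z0 k \<le> ?l x' k" for k using z_ge z_x' by (rule le_trans)
  then have "x' \<in> Z" using x' by (simp add: Z_def)
  then have "\<not> modulus n z < modulus n x'" using z(2) by (simp add: not_less)
  then have eq: "?l x' k = ?l z k" for k
  proof (cases "k \<in> {1..n}")
    case True
    then show ?thesis
      using modulus_less[OF z_x' True] z_x'[of k] \<open>\<not> modulus n z < modulus n x'\<close> by linarith
  next
    case False
    then show ?thesis
      using polymatroid_lookup_outside[OF P x'(1)] polymatroid_lookup_outside[OF P zP] by metis
  qed
  obtain k where k: "?l z k < ?l x k" using x(4) by blast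
  then have "?l z k = ?l ?vi k" using eq[of k] by (simp add: x' min_def split: if_splits)
  then have "k = j" "?l v j \<le> ?l z j"
    using k x(3)[of k] unfolding look by (auto split: if_splits)
  then show False using \<open>?l z j < ?l v j\<close> by simp
qed

lemma basesI_rank:
  assumes "discrete_polymatroid n P" "v \<in> P" "polymatroid_rank n P \<le> modulus n v"
  shows "v \<in> bases n P"
proof -
  have "finite (modulus n ` P)" using assms(1) by (simp add: discrete_polymatroid_def)
  then have "modulus n w \<le> polymatroid_rank n P" if "w \<in> P" for w
    using that by (simp add: polymatroid_rank_def)
  then show ?thesis using assms(2,3) by (auto simp: bases_def intro: le_trans)
qed

lemma bases_modulus:
  assumes "discrete_polymatroid n P" "b \<in> bases n P"
  shows "modulus n b = polymatroid_rank n P"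
  unfolding polymatroid_rank_def using assms
  by (intro Max_eqI[symmetric]) (auto simp: bases_def discrete_polymatroid_def)

lemma bases_nonempty:
  assumes P: "discrete_polymatroid n P" shows "bases n P \<noteq> {}"
proof -
  have "polymatroid_rank n P \<in> modulus n ` P"
    unfolding polymatroid_rank_def using P by (intro Max_in) (auto simp: discrete_polymatroid_def)
  then obtain v where "v \<in> P" "modulus n v = polymatroid_rank n P" by auto
  then show ?thesis using basesI_rank[OF P] by force
qed

lemma finite_bases: "discrete_polymatroid n P \<Longrightarrow> finite (bases n P)"
  by (simp add: bases_def discrete_polymatroid_def)

lemma vsum_le_rank_fun:
  assumes "discrete_polymatroid n P" "b \<in> bases n P"
  shows "vsum b F \<le> rank_fun n P F"
  using assms finite_bases[OF assms(1)] by (auto simp: rank_fun_def vsum_def)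

lemma rank_fun_le:
  assumes "discrete_polymatroid n P" "\<And>b. b \<in> bases n P \<Longrightarrow> vsum b F \<le> k"
  shows "rank_fun n P F \<le> k"
  using assms finite_bases[OF assms(1)] bases_nonempty[OF assms(1)] by (auto simp: rank_fun_def)

section \<open>Exponents that dominate a basis\<close>

lemma compl_rank_fun_le_vsum:
  assumes P: "discrete_polymatroid n P" and b: "b \<in> bases n P" and F: "F \<subseteq> {1..n}"
    and le: "\<And>i. Poly_Mapping.lookup b i \<le> Poly_Mapping.lookup u i"
  shows "compl_rank_fun n P F \<le> vsum u F"
proof -
  have "vsum b F \<le> vsum u F" by (rule vsum_mono) (rule le)
  then show ?thesis
    using vsum_le_rank_fun[OF P b, of "{1..n} - F"] bases_modulus[OF P b] modulus_split[OF F, of b]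
    unfolding compl_rank_fun_def by linarith
qed

text \<open>
  A member \<open>v\<close> of largest modulus below \<open>u\<close> is a basis. Every direction \<open>i\<close> is either blocked by \<open>P\<close>
  (\<open>i \<in> T\<close>) or blocked by \<open>u\<close> (\<open>v\<^sub>i = u\<^sub>i\<close>). On \<open>T\<close> the value \<open>v(T)\<close> is at least the rank, and off
  \<open>T\<close> it equals that of \<open>u\<close>, which the inequality for the complement of \<open>T\<close> bounds from below.
\<close>

lemma dominates_basis_if_inequalities:
  assumes P: "discrete_polymatroid n P"
    and ineq: "\<And>F. F \<subseteq> {1..n} \<Longrightarrow> compl_rank_fun n P F \<le> vsum u F"
  obtains b where "b \<in> bases n P" "\<And>i. Poly_Mapping.lookup b i \<le> Poly_Mapping.lookup u i"
proof -
  let ?l = Poly_Mapping.lookup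
  define Z where "Z = {v \<in> P. \<forall>i. ?l v i \<le> ?l u i}"
  obtain v0 where "v0 \<in> P" using P by (auto simp: discrete_polymatroid_def)
  obtain z0 where "z0 \<in> P" "\<And>i. ?l z0 i = 0"
    using polymatroid_down[OF P \<open>v0 \<in> P\<close>, of "\<lambda>_. 0"] by auto
  then have "z0 \<in> Z" by (simp add: Z_def)
  moreover have "finite Z" using P by (auto simp: Z_def discrete_polymatroid_def)
  ultimately obtain v where v: "v \<in> Z" "\<And>x. x \<in> Z \<Longrightarrow> modulus n x \<le> modulus n v"
    using ex_max_if_finite[of Z _ "modulus n"] by blast
  have vP: "v \<in> P" and vu: "\<And>i. ?l v i \<le> ?l u i" using v(1) by (auto simp: Z_def)
  define T where "T = {i \<in> {1..n}. v + Poly_Mapping.single i 1 \<notin> P}"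
  have T: "T \<subseteq> {1..n}" by (auto simp: T_def)
  have rank: "rank_fun n P T \<le> vsum v T"
    using blocked_directions_tight[OF P vP] by (intro rank_fun_le[OF P]) (simp add: T_def bases_def)
  have "?l u i = ?l v i" if i: "i \<in> {1..n} - T" for i
  proof (rule ccontr)
    assume "?l u i \<noteq> ?l v i"
    then have "v + Poly_Mapping.single i 1 \<in> Z"
      using i vu by (auto simp: Z_def T_def lookup_add lookup_single when_def le_neq_implies_less Suc_leI)
    then show False using v(2) modulus_add_unit[of i n v] i by fastforce
  qed
  then have "vsum u ({1..n} - T) = vsum v ({1..n} - T)" by (simp add: vsum_def)
  moreover have "{1..n} - ({1..n} - T) = T" using T by blast
  ultimately have "polymatroid_rank n P \<le> modulus n v"
    using ineq[of "{1..n} - T"] rank modulus_split[OF T, of v] by (simp add: compl_rank_fun_def)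
  then show ?thesis using that basesI_rank[OF P vP] vu by blast
qed

text \<open>
  A violated inequality at a non-closed or separable set forces a violated one at a proper subset.
  The reason is that \<open>u\<close> is monotone and additive on sets.
\<close>

lemma closed_inseparable_inequalities_suffice:
  assumes ineq: "\<And>F. F \<subseteq> S \<Longrightarrow> tau_closed \<tau> F \<Longrightarrow> tau_inseparable \<tau> F \<Longrightarrow> \<tau> F \<le> vsum u F"
    and fin: "finite S" and "F \<subseteq> S"
  shows "\<tau> F \<le> vsum u F"
proof -
  have "finite F" using assms(3) fin finite_subset by blast
  then show ?thesis using assms(3)
  proof (induction F rule: finite_psubset_induct)
    case (psubset F)
    consider "tau_closed \<tau> F" "tau_inseparable \<tau> F" | "\<not> tau_closed \<tau> F" | "tau_separable \<tau> F"
      by blast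
    then show ?case
    proof cases
      case 1
      then show ?thesis using ineq psubset.prems by blast
    next
      case 2
      then obtain G where G: "G \<subset> F" "\<tau> F \<le> \<tau> G" by (auto simp: tau_closed_def not_less)
      have "\<tau> G \<le> vsum u G" using psubset.IH[OF G(1)] G(1) psubset.prems by blast
      also have "\<dots> \<le> vsum u F"
        unfolding vsum_def using G(1) psubset.hyps by (intro sum_mono2) auto
      finally show ?thesis using G(2) by simp
    next
      case 3
      then obtain G H where GH: "G \<noteq> {}" "H \<noteq> {}" "G \<inter> H = {}" "G \<union> H = F" "\<tau> G + \<tau> H = \<tau> F"
        by (auto simp: tau_separable_def)
      then have "G \<subset> F" "H \<subset> F" by auto
      then have "\<tau> G \<le> vsum u G" "\<tau> H \<le> vsum u H" using psubset by auto
      moreover have "vsum u F = vsum u G + vsum u H"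
        using GH psubset.hyps unfolding vsum_def
        by (metis finite_Un sum.union_disjoint)
      ultimately show ?thesis using GH(5) by simp
    qed
  qed
qed

lemma dominates_basis_iff:
  assumes P: "discrete_polymatroid n P" and u: "u \<in> expvecs n"
  defines "\<tau> \<equiv> compl_rank_fun n P"
  shows "(\<exists>b\<in>bases n P. \<exists>w\<in>expvecs n. u = b + w) \<longleftrightarrow>
    (\<forall>F \<subseteq> {1..n}. tau_closed \<tau> F \<longrightarrow> tau_inseparable \<tau> F \<longrightarrow> \<tau> F \<le> vsum u F)"
proof
  assume "\<exists>b\<in>bases n P. \<exists>w\<in>expvecs n. u = b + w"
  then obtain b w where b: "b \<in> bases n P" "u = b + w" by blast
  then have "Poly_Mapping.lookup b i \<le> Poly_Mapping.lookup u i" for i by (simp add: lookup_add)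
  then show "\<forall>F \<subseteq> {1..n}. tau_closed \<tau> F \<longrightarrow> tau_inseparable \<tau> F \<longrightarrow> \<tau> F \<le> vsum u F"
    using compl_rank_fun_le_vsum[OF P b(1)] unfolding \<tau>_def by blast
next
  assume "\<forall>F \<subseteq> {1..n}. tau_closed \<tau> F \<longrightarrow> tau_inseparable \<tau> F \<longrightarrow> \<tau> F \<le> vsum u F"
  then have "\<tau> F \<le> vsum u F" if "F \<subseteq> {1..n}" for F
    using closed_inseparable_inequalities_suffice[of "{1..n}" \<tau> u F] that by blast
  then obtain b where b: "b \<in> bases n P" "\<And>i. Poly_Mapping.lookup b i \<le> Poly_Mapping.lookup u i"
    using dominates_basis_if_inequalities[OF P, of u] unfolding \<tau>_def by blast
  have "u = b + (u - b)"
    using b(2) by (intro poly_mapping_eqI) (simp add: lookup_add lookup_minus)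
  then show "\<exists>b\<in>bases n P. \<exists>w\<in>expvecs n. u = b + w"
    using b(1) diff_in_expvecs[OF u] by blast
qed

section \<open>The intersection formula\<close>

theorem theorem2p6:
  fixes n :: nat and P :: "expvec set" and \<tau> :: "nat set \<Rightarrow> nat"
  assumes "discrete_polymatroid n P"
    and "\<tau> = compl_rank_fun n P"
  shows "(polymatroidal_ideal n P :: (expvec \<Rightarrow>\<^sub>0 'k::field) set) =
    (\<Inter>F\<in>{F. F \<subseteq> {1..n} \<and> tau_closed \<tau> F \<and> tau_inseparable \<tau> F}.
       ideal_power n (monomial_prime n F) (\<tau> F))"
proof -
  let ?C = "{F. F \<subseteq> {1..n} \<and> tau_closed \<tau> F \<and> tau_inseparable \<tau> F}"
  have sub: "bases n P \<subseteq> expvecs n"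
    using assms(1) by (auto simp: bases_def discrete_polymatroid_def)
  \<comment> \<open>The empty set belongs to the index set, so the intersection is over a nonempty family and
    stays inside the polynomial ring.\<close>
  have empty: "{} \<in> ?C" by (auto simp: tau_closed_def tau_separable_def)
  have "{b + w | b w. b \<in> bases n P \<and> w \<in> expvecs n}
      = (\<Inter>F\<in>?C. {u \<in> expvecs n. \<tau> F \<le> vsum u F})" (is "?D = ?E")
  proof (rule Set.set_eqI)
    fix u
    show "u \<in> ?D \<longleftrightarrow> u \<in> ?E"
    proof (cases "u \<in> expvecs n")
      case True
      then show ?thesis
        using dominates_basis_iff[OF assms(1) True] unfolding assms(2) by blast
    next
      case False
      then have "u \<notin> ?D" using sub add_in_expvecs by blast
      moreover have "u \<notin> ?E" using False empty by blast
      ultimately show ?thesis by blast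
    qed
  qed
  then have "(polymatroidal_ideal n P :: (expvec \<Rightarrow>\<^sub>0 'k) set) = supported_on ?E"
    unfolding polymatroidal_ideal_def genideal_monomials[OF sub] by simp
  also have "\<dots> = (\<Inter>F\<in>?C. supported_on {u \<in> expvecs n. \<tau> F \<le> vsum u F})"
    unfolding supported_on_def by blast
  also have "\<dots> = (\<Inter>F\<in>?C. ideal_power n (monomial_prime n F) (\<tau> F))"
    by (intro INF_cong) (auto simp: monomial_prime_power_supported_on)
  finally show ?thesis .
qed

end
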